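(* Let $0<p<1$ be a constant and let $F$ be an arbitrary graph (without isolated vertices). Then there exists a constant $C=C(F,p)>0$ such that with probability tending to $1$ as $n\to\infty$, $$\mathrm{sat}\left(G(n,p),F\right)\le C\, n\ln n,$$ i.e. with high probability $\mathrm{sat}(G(n,p),F)=O(n\ln n)$.
   Context: $G(n,p)$ is the binomial random graph on vertex set $[n]$ where each pair is an edge independently with probability $p$. For graphs $G$ and $F$, a subgraph $H\subseteq G$ is $F$-saturated in $G$ if $H$ contains no copy of $F$ as a subgraph, but adding any edge $e\in E(G)\setminus E(H)$ to $H$ creates a copy of $F$. The saturation number $\mathrm{sat}(G,F)$ is the minimum number of edges of an $F$-saturated subgraph of $G$. Throughout, graphs $F$ are assumed to have no isolated vertices. *)

theory Defs
  imports "HOL-Library.Ramsey" "HOL-Probability.Probability" "HOL-Probability.Product_PMF"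
begin

text \<open>A graph is a pair of a vertex set and a set of two-element subsets of it.\<close>

type_synonym 'a graph = "'a set \<times> 'a set set"

abbreviation verts :: "'a graph \<Rightarrow> 'a set" where "verts \<equiv> fst"
abbreviation edges :: "'a graph \<Rightarrow> 'a set set" where "edges \<equiv> snd"

definition fin_graph :: "'a graph \<Rightarrow> bool" where
  "fin_graph G \<longleftrightarrow> finite (verts G) \<and> edges G \<subseteq> nsets (verts G) 2"

definition no_isolated_verts :: "'a graph \<Rightarrow> bool" where
  "no_isolated_verts G \<longleftrightarrow> (\<forall>v\<in>verts G. \<exists>e\<in>edges G. v \<in> e)"

definition subgraph :: "'a graph \<Rightarrow> 'a graph \<Rightarrow> bool" where
  "subgraph H G \<longleftrightarrow> fin_graph H \<and> verts H \<subseteq> verts G \<and> edges H \<subseteq> edges G"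

definition contains_copy :: "'a graph \<Rightarrow> 'b graph \<Rightarrow> bool" where
  "contains_copy H F \<longleftrightarrow>
     (\<exists>f. inj_on f (verts F) \<and> f ` verts F \<subseteq> verts H \<and> (\<forall>e\<in>edges F. f ` e \<in> edges H))"

text \<open>Subgraphs need not be spanning, so adding an edge also adds its endpoints.\<close>

definition add_edge :: "'a set \<Rightarrow> 'a graph \<Rightarrow> 'a graph" where
  "add_edge e H = (verts H \<union> e, insert e (edges H))"

definition saturated_in :: "'a graph \<Rightarrow> 'a graph \<Rightarrow> 'b graph \<Rightarrow> bool" where
  "saturated_in H G F \<longleftrightarrow>
     subgraph H G \<and> \<not> contains_copy H F \<and>
     (\<forall>e\<in>edges G - edges H. contains_copy (add_edge e H) F)"

text \<open>By \<open>saturated_in_exists\<close> below, the minimum is over a nonempty set whenever \<open>F\<close> is nonempty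
  and has no isolated vertices.\<close>

definition sat :: "'a graph \<Rightarrow> 'b graph \<Rightarrow> nat" where
  "sat G F = (LEAST m. \<exists>H. saturated_in H G F \<and> card (edges H) = m)"

definition gnp :: "nat \<Rightarrow> real \<Rightarrow> nat graph pmf" where
  "gnp n p = map_pmf (\<lambda>X. ({1..n}, {e \<in> nsets {1..n} 2. X e}))
               (Pi_pmf (nsets {1..n} 2) False (\<lambda>_. bernoulli_pmf p))"

lemma saturated_in_exists:
  fixes G :: "'a graph" and F :: "'b graph"
  assumes G: "fin_graph G" and F: "verts F \<noteq> {}" "no_isolated_verts F"
  shows "\<exists>H. saturated_in H G F"
proof -
  define A where "A = {E. E \<subseteq> edges G \<and> \<not> contains_copy (verts G, E) F}"
  have fin: "finite (edges G)"
    using G finite_subset[OF _ finite_imp_finite_nsets] unfolding fin_graph_def by blast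
  have "finite A"
    by (rule finite_subset[of _ "Pow (edges G)"]) (use fin in \<open>auto simp: A_def\<close>)
  moreover have "{} \<in> A"
    using F by (auto simp: A_def contains_copy_def no_isolated_verts_def)
  ultimately obtain E where E: "E \<in> A" and mx: "\<And>E'. E' \<in> A \<Longrightarrow> E \<subseteq> E' \<Longrightarrow> E = E'"
    using finite_has_maximal[of A] by blast
  have "contains_copy (add_edge e (verts G, E)) F" if e: "e \<in> edges G - E" for e
  proof (rule ccontr)
    assume neg: "\<not> ?thesis"
    have "verts G \<union> e = verts G"
      using G e by (auto simp: fin_graph_def nsets_def)
    with neg e E have "insert e E \<in> A" by (auto simp: A_def add_edge_def)
    with mx[of "insert e E"] e show False by blast
  qed
  with E G have "saturated_in (verts G, E) G F"
    by (auto simp: saturated_in_def subgraph_def fin_graph_def A_def)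
  then show ?thesis ..
qed

lemma sat_attained:
  assumes "fin_graph G" "verts F \<noteq> {}" "no_isolated_verts F"
  shows "\<exists>H. saturated_in H G F \<and> card (edges H) = sat G F"
  unfolding sat_def by (rule LeastI_ex) (use saturated_in_exists[OF assms] in blast)

end

theory Submission imports Defs "HOL-Real_Asymp.Real_Asymp" begin

text \<open>
Let \<open>F\<close> have chromatic number \<open>r + 2\<close>. Reserve \<open>L = O(ln n)\<close> disjoint sets ("columns") of constant
size. With high probability every vertex set \<open>U\<close> of bounded size has a column that is a clique
completely joined to \<open>U\<close>.

Each column supplies vertices for \<open>r\<close> independent colour classes, which together play the role of
\<open>r\<close> colours of \<open>F\<close>. The remaining two colours are handled by a disjoint union of complete
bipartite graphs: \<open>a\<close> of the form \<open>K(s+1, *)\<close> and all others of the form \<open>K(s, *)\<close>, where \<open>(s, a)\<close>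
is critical, in that this host does not contain \<open>F\<close>, but does after one more \<open>K(s, *)\<close> is enlarged
to \<open>K(s+1, *)\<close>. Every other vertex \<open>y\<close> is attached to the \<open>s\<close>-set of a column \<open>t y\<close> to which it is
completely joined.

In any \<open>F\<close>-free extension of this graph inside \<open>G(n,p)\<close>, a vertex \<open>b\<close> has at most \<open>|V(F)|\<close> neighbours
among the \<open>y\<close> with \<open>t y = j\<close>, as otherwise \<open>b\<close> enlarges the \<open>s\<close>-set of column \<open>j\<close> and completes a
copy of \<open>F\<close>. Thus every saturated extension has \<open>O(n L)\<close> edges.
\<close>

section \<open>Colourings by host graphs and the critical pair\<close>

text \<open>
\<open>fits F r s a c l\<close> says that \<open>F\<close> embeds into the host graph above: colours below \<open>r\<close> are
unrestricted, and the colours \<open>r\<close> (small sides) and \<open>r + 1\<close> (large sides) span bipartite pieces named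
by the label \<open>l\<close>.
\<close>

definition fits :: "'a graph \<Rightarrow> nat \<Rightarrow> nat \<Rightarrow> nat \<Rightarrow> ('a \<Rightarrow> nat) \<Rightarrow> ('a \<Rightarrow> nat) \<Rightarrow> bool" where
  "fits F r s a c l \<longleftrightarrow>
     (\<forall>x\<in>verts F. c x \<le> Suc r) \<and>
     (\<forall>x y. {x, y} \<in> edges F \<longrightarrow> c x \<noteq> c y \<and> (r \<le> c x \<longrightarrow> r \<le> c y \<longrightarrow> l x = l y)) \<and>
     (\<forall>i. card {x \<in> verts F. c x = r \<and> l x = i} \<le> s + of_bool (i < a))"

lemma fitsD:
  assumes "fits F r s a c l"
  shows "x \<in> verts F \<Longrightarrow> c x \<le> Suc r"
    and "{x, y} \<in> edges F \<Longrightarrow> c x \<noteq> c y"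
    and "{x, y} \<in> edges F \<Longrightarrow> r \<le> c x \<Longrightarrow> r \<le> c y \<Longrightarrow> l x = l y"
    and "card {x \<in> verts F. c x = r \<and> l x = i} \<le> s + of_bool (i < a)"
  using assms unfolding fits_def by blast+

lemma fin_graph_edgeD:
  assumes "fin_graph G" "{x, y} \<in> edges G"
  shows "x \<in> verts G" "y \<in> verts G" "x \<noteq> y"
proof -
  have "{x, y} \<in> nsets (verts G) 2"
    using assms unfolding fin_graph_def by blast
  then show "x \<in> verts G" "y \<in> verts G" "x \<noteq> y" by simp_all
qed

definition joined_column :: "'a set set \<Rightarrow> 'a set \<Rightarrow> 'a set \<Rightarrow> bool" where
  "joined_column E D U \<longleftrightarrow> D \<inter> U = {} \<and> (\<forall>x\<in>D. \<forall>y\<in>D \<union> U. x \<noteq> y \<longrightarrow> {x, y} \<in> E)"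

text \<open>Composing the colouring and labels of \<open>H\<close> with an embedding of
  \<open>F\<close> preserves both edge conditions, and injectivity keeps the small sides within
  their capacity. So a host that fits parameters which \<open>F\<close> does not fit is
  \<open>F\<close>-free.\<close>

lemma fits_pullback:
  assumes "fits H r s a c l" "finite (verts H)" "contains_copy H F"
  shows "\<exists>c l. fits F r s a c l"
proof -
  obtain f where f: "inj_on f (verts F)" "f ` verts F \<subseteq> verts H" "\<forall>e\<in>edges F. f ` e \<in> edges H"
    using assms(3) unfolding contains_copy_def by blast
  have E: "{f x, f y} \<in> edges H" if "{x, y} \<in> edges F" for x y
    using f(3) that by fastforce
  have "card {x \<in> verts F. c (f x) = r \<and> l (f x) = i} \<le> s + of_bool (i < a)" for i
  proof -
    have "card {x \<in> verts F. c (f x) = r \<and> l (f x) = i} \<le> card {y \<in> verts H. c y = r \<and> l y = i}"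
      by (rule card_inj_on_le[of f])
        (use f assms(2) in \<open>auto intro: inj_on_subset\<close>)
    with fitsD(4)[OF assms(1), of i] show ?thesis by linarith
  qed
  then have "fits F r s a (c \<circ> f) (l \<circ> f)"
    using f(2) fitsD(1-3)[OF assms(1)] E unfolding fits_def by (auto simp: image_subset_iff)
  then show ?thesis by blast
qed

text \<open>Labels from \<open>a\<close> on all have the same capacity \<open>s\<close>, and at most
  \<open>card (verts F)\<close> of them occur, so they can be moved injectively into an interval of
  that length while labels below \<open>a\<close> stay fixed. This bounds in advance the number of
  pieces to reserve.\<close>

lemma fits_relabel:
  assumes F: "fin_graph F" and fit: "fits F r s a c l"
  shows "\<exists>l'. fits F r s a c l' \<and> (\<forall>x\<in>verts F. l' x < a + card (verts F))"
proof -
  define M where "M = l ` verts F - {..<a}"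
  have finV: "finite (verts F)" using F by (simp add: fin_graph_def)
  then have "finite M" by (simp add: M_def)
  moreover have "card M \<le> card {a..<a + card (verts F)}"
    using card_mono[of "l ` verts F" M] card_image_le[OF finV, of l] finV by (auto simp: M_def)
  ultimately obtain h where h: "h ` M \<subseteq> {a..<a + card (verts F)}" "inj_on h M"
    using card_le_inj[of M "{a..<a + card (verts F)}"] by auto
  define k where "k i = (if i < a then i else h i)" for i
  have hM: "a \<le> h (l x)" "h (l x) < a + card (verts F)" if "x \<in> verts F" "\<not> l x < a" for x
    using subsetD[OF h(1), of "h (l x)"] that by (auto simp: M_def)
  have range: "k (l x) < a + card (verts F)" "k (l x) < a \<longleftrightarrow> l x < a" if "x \<in> verts F" for x
    using hM[of x] that by (auto simp: k_def)
  have inj: "l x = l y" if "x \<in> verts F" "y \<in> verts F" "k (l x) = k (l y)" for x y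
    using that range(2)[of x] range(2)[of y] h(2) by (auto simp: inj_on_def k_def M_def split: if_splits)
  have "card {x \<in> verts F. c x = r \<and> k (l x) = i} \<le> s + of_bool (i < a)" for i
  proof (cases "\<exists>x\<in>verts F. k (l x) = i")
    case True
    then obtain x where x: "x \<in> verts F" "k (l x) = i" by blast
    have "{y \<in> verts F. c y = r \<and> k (l y) = i} = {y \<in> verts F. c y = r \<and> l y = l x}"
      using inj[OF _ x(1)] x(2) by auto
    then show ?thesis using fitsD(4)[OF fit, of "l x"] range(2)[OF x(1)] x(2) by simp
  next
    case False
    then have "{y \<in> verts F. c y = r \<and> k (l y) = i} = {}" by blast
    then show ?thesis by (metis card.empty zero_le)
  qed
  then have "fits F r s a c (k \<circ> l)"
    using fit unfolding fits_def by auto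
  with range(1) show ?thesis by auto
qed

text \<open>Two discrete jumps. With \<open>r + 2\<close> the chromatic number, capacity 0 is too
  small and capacity \<open>card (verts F)\<close> suffices, so some \<open>s\<close> fails while
  \<open>Suc s\<close> works. A fit of capacity \<open>Suc s\<close> uses at most
  \<open>card (verts F)\<close> labels, so granting one extra place to that many pieces also works,
  and the jump in \<open>a\<close> lies below.\<close>

lemma critical_fit_exists:
  assumes F: "fin_graph F" "edges F \<noteq> {}"
  shows "\<exists>r s a. \<not> (\<exists>c l. fits F r s a c l) \<and> (\<exists>c l. fits F r s (Suc a) c l)"
proof -
  define v where "v = card (verts F)"
  define P where "P k \<longleftrightarrow> (\<exists>c. (\<forall>x\<in>verts F. c x < k) \<and> (\<forall>x y. {x, y} \<in> edges F \<longrightarrow> c x \<noteq> c y))"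
    for k :: nat
  have finV: "finite (verts F)" using F by (simp add: fin_graph_def)
  obtain e where "e \<in> edges F" using F by blast
  moreover from this have "card e = 2" using F by (auto simp: fin_graph_def nsets_def)
  ultimately obtain x0 y0 where xy: "{x0, y0} \<in> edges F" by (metis card_2_iff)
  note xyV = fin_graph_edgeD[OF F(1) xy]
  obtain h where h: "bij_betw h (verts F) {..<v}"
    using finite_same_card_bij[OF finV, of "{..<v}"] unfolding v_def by auto
  have "P v"
    unfolding P_def
  proof (intro exI[of _ h] conjI ballI allI impI)
    show "h x < v" if "x \<in> verts F" for x
      using bij_betwE[OF h] that by auto
    show "h x \<noteq> h y" if "{x, y} \<in> edges F" for x y
      using fin_graph_edgeD[OF F(1) that] inj_onD[OF bij_betw_imp_inj_on[OF h]] by blast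
  qed
  moreover have "\<not> P 0" using xyV by (auto simp: P_def)
  ultimately obtain k where k: "\<not> P k" "P (Suc k)"
    using ex_least_nat_less[of P v] by blast
  \<comment> \<open>An edge excludes a colouring with one colour, so \<open>k\<close> is positive
    and can be written \<open>Suc r\<close>.\<close>
  have "\<not> P 1" using xyV xy unfolding P_def by (metis less_one)
  with k obtain r where r: "P (Suc (Suc r))" "\<not> P (Suc r)"
    by (cases k) auto
  define Fit where "Fit s a \<longleftrightarrow> (\<exists>c l. fits F r s a c l)" for s a
  have "\<not> Fit 0 0"
  proof
    assume "Fit 0 0"
    then obtain c l where cl: "fits F r 0 0 c l" unfolding Fit_def by blast
    have nr: "c x \<noteq> r" if "x \<in> verts F" for x
      using fitsD(4)[OF cl, of "l x"] that finV by auto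
    \<comment> \<open>No vertex has colour \<open>r\<close>, so colour \<open>Suc r\<close> can take
      its name, which saves a colour.\<close>
    have "P (Suc r)"
      unfolding P_def
    proof (intro exI[of _ "\<lambda>x. if c x = Suc r then r else c x"] conjI ballI allI impI)
      fix x assume "x \<in> verts F"
      then show "(if c x = Suc r then r else c x) < Suc r"
        using fitsD(1)[OF cl, of x] by auto
    next
      fix x y assume e: "{x, y} \<in> edges F"
      then show "(if c x = Suc r then r else c x) \<noteq> (if c y = Suc r then r else c y)"
        using fitsD(2)[OF cl e] nr fin_graph_edgeD[OF F(1) e] by auto
    qed
    with r show False by blast
  qed
  moreover have "Fit v 0"
  proof -
    obtain c where c: "\<forall>x\<in>verts F. c x < Suc (Suc r)" "\<forall>x y. {x, y} \<in> edges F \<longrightarrow> c x \<noteq> c y"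
      using r(1) unfolding P_def by blast
    have "fits F r v 0 c (\<lambda>_. 0)"
      using c finV by (auto simp: fits_def v_def less_Suc_eq_le intro!: card_mono)
    then show ?thesis unfolding Fit_def by blast
  qed
  ultimately obtain s where s: "\<not> Fit s 0" "Fit (Suc s) 0"
    using ex_least_nat_less[of "\<lambda>s. Fit s 0" v] by blast
  obtain c l where "fits F r (Suc s) 0 c l" using s(2) unfolding Fit_def by blast
  then obtain l where l: "fits F r (Suc s) 0 c l" "\<forall>x\<in>verts F. l x < v"
    using fits_relabel[OF F(1)] by (fastforce simp: v_def)
  have "card {x \<in> verts F. c x = r \<and> l x = i} \<le> s + of_bool (i < v)" for i
  proof (cases "i < v")
    case True
    then show ?thesis using fitsD(4)[OF l(1), of i] by simp
  next
    case False
    then have "{x \<in> verts F. c x = r \<and> l x = i} = {}" using l(2) by auto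
    then show ?thesis by (metis card.empty zero_le)
  qed
  then have "fits F r s v c l" using l(1) unfolding fits_def by blast
  then have "Fit s v" unfolding Fit_def by blast
  with s(1) obtain a where "\<not> Fit s a" "Fit s (Suc a)"
    using ex_least_nat_less[of "Fit s" v] by blast
  then show ?thesis unfolding Fit_def by blast
qed

section \<open>Assembling embeddings and saturated extensions\<close>

text \<open>\<open>m\<close> reads the class off a target vertex, so target sets of different
  classes are disjoint and injections chosen class by class can be glued.\<close>

lemma classwise_injection:
  assumes "finite V"
    and fin: "\<And>x. x \<in> V \<Longrightarrow> finite (S (k x))"
    and card: "\<And>x. x \<in> V \<Longrightarrow> card {y \<in> V. k y = k x} \<le> card (S (k x))"
    and tgt: "\<And>x y. x \<in> V \<Longrightarrow> y \<in> S (k x) \<Longrightarrow> m y = k x"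
  shows "\<exists>f. inj_on f V \<and> (\<forall>x\<in>V. f x \<in> S (k x))"
proof -
  have "\<forall>i\<in>k ` V. \<exists>f. f ` {y \<in> V. k y = i} \<subseteq> S i \<and> inj_on f {y \<in> V. k y = i}"
    using assms(1) fin card by (auto intro!: card_le_inj)
  then obtain f where f: "\<And>i. i \<in> k ` V \<Longrightarrow> f i ` {y \<in> V. k y = i} \<subseteq> S i"
      "\<And>i. i \<in> k ` V \<Longrightarrow> inj_on (f i) {y \<in> V. k y = i}"
    by metis
  have mem: "f (k x) x \<in> S (k x)" if "x \<in> V" for x
    using f(1)[of "k x"] that by auto
  have "inj_on (\<lambda>x. f (k x) x) V"
  proof (rule inj_onI)
    fix x y assume xy: "x \<in> V" "y \<in> V" "f (k x) x = f (k y) y"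
    then have "k x = k y" using tgt[OF _ mem] by metis
    with xy f(2)[of "k x"] show "x = y" by (auto simp: inj_on_def)
  qed
  with mem show ?thesis by blast
qed

text \<open>Among the finitely many \<open>F\<close>-free edge sets of \<open>G\<close> above
  \<open>E0\<close>, a maximal one is saturated. This keeps the host graph inside the saturated
  graph whose edges are counted.\<close>

lemma saturated_extension:
  assumes G: "fin_graph G" and E0: "E0 \<subseteq> edges G" "\<not> contains_copy (verts G, E0) F"
  shows "\<exists>E. E0 \<subseteq> E \<and> saturated_in (verts G, E) G F"
proof -
  define A where "A = {E. E0 \<subseteq> E \<and> E \<subseteq> edges G \<and> \<not> contains_copy (verts G, E) F}"
  have fin: "finite (edges G)"
    using G finite_subset[OF _ finite_imp_finite_nsets] unfolding fin_graph_def by blast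
  have "finite A"
    by (rule finite_subset[of _ "Pow (edges G)"]) (use fin in \<open>auto simp: A_def\<close>)
  moreover have "E0 \<in> A"
    using E0 by (auto simp: A_def)
  ultimately obtain E where E: "E \<in> A" and mx: "\<And>E'. E' \<in> A \<Longrightarrow> E \<subseteq> E' \<Longrightarrow> E = E'"
    using finite_has_maximal[of A] by blast
  have "contains_copy (add_edge e (verts G, E)) F" if e: "e \<in> edges G - E" for e
  proof (rule ccontr)
    assume neg: "\<not> ?thesis"
    have "verts G \<union> e = verts G"
      using G e by (auto simp: fin_graph_def nsets_def)
    with neg e E have "insert e E \<in> A" by (auto simp: A_def add_edge_def)
    with mx[of "insert e E"] e show False by blast
  qed
  with E G have "saturated_in (verts G, E) G F"
    by (auto simp: saturated_in_def subgraph_def fin_graph_def A_def)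
  with E show ?thesis by (auto simp: A_def)
qed

section \<open>Column positions and the deterministic bound\<close>

text \<open>
Positions in a column, tagged by the first component: 0 for the \<open>r\<close> ordinary colours, 1 for the
\<open>s\<close>-set to which outside vertices are attached, 2 and 3 for the two sides of \<open>R\<close> reserved bipartite
pieces. Only one column, \<open>j0\<close> below, uses its positions 2 and 3.
\<close>

definition column_roles :: "nat \<Rightarrow> nat \<Rightarrow> nat \<Rightarrow> nat \<Rightarrow> nat \<Rightarrow> (nat \<times> nat \<times> nat) set" where
  "column_roles r s a v R =
     {0} \<times> {..<r} \<times> {..<v} \<union> {1} \<times> {0} \<times> {..<s} \<union>
     {2} \<times> (SIGMA i:{..<R}. {..<s + of_bool (i < a)}) \<union> {3} \<times> {..<R} \<times> {..<v}"

lemma finite_column_roles [simp]: "finite (column_roles r s a v R)"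
  by (simp add: column_roles_def)

lemma column_roles_iff [simp]:
  "(0, i, u) \<in> column_roles r s a v R \<longleftrightarrow> i < r \<and> u < v"
  "(Suc 0, i, u) \<in> column_roles r s a v R \<longleftrightarrow> i = 0 \<and> u < s"
  "(2, i, u) \<in> column_roles r s a v R \<longleftrightarrow> i < R \<and> u < s + of_bool (i < a)"
  "(3, i, u) \<in> column_roles r s a v R \<longleftrightarrow> i < R \<and> u < v"
  by (auto simp: column_roles_def)

lemma column_roles_cases:
  assumes "q \<in> column_roles r s a v R"
  obtains (A) i u where "q = (0, i, u)" "i < r" "u < v"
    | (T) u where "q = (Suc 0, 0, u)" "u < s"
    | (X) i u where "q = (2, i, u)" "i < R" "u < s + of_bool (i < a)"
    | (Y) i u where "q = (3, i, u)" "i < R" "u < v"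
  using assms by (auto simp: column_roles_def)

text \<open>Edges meeting \<open>B\<close> number at most \<open>card (verts G) * card B\<close>.
  Any other edge is determined by one end \<open>b\<close>, the class \<open>t y\<close> of the
  other end, and one of at most \<open>d\<close> choices of \<open>y\<close> in that class.\<close>

lemma card_edges_le:
  assumes G: "fin_graph G" and B: "B \<subseteq> verts G"
    and few: "\<And>b j. b \<in> verts G - B \<Longrightarrow> j < L \<Longrightarrow>
      card {y \<in> verts G - B. t y = j \<and> {b, y} \<in> edges G} \<le> d"
    and t: "\<And>y. y \<in> verts G \<Longrightarrow> t y < L"
  shows "card (edges G) \<le> card (verts G) * (card B + L * d)"
proof -
  let ?V = "verts G"
  let ?N = "\<lambda>b j. {y \<in> ?V - B. t y = j \<and> {b, y} \<in> edges G}"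
  have finV: "finite ?V" using G by (simp add: fin_graph_def)
  have finB: "finite B" using B finV by (rule finite_subset)
  let ?E1 = "(\<lambda>(x, y). {x, y}) ` (?V \<times> B)"
  let ?E2 = "\<Union>b\<in>?V - B. \<Union>j<L. (\<lambda>y. {b, y}) ` ?N b j"
  have "edges G \<subseteq> ?E1 \<union> ?E2"
  proof
    fix e assume e: "e \<in> edges G"
    then have "card e = 2" using G by (auto simp: fin_graph_def nsets_def)
    then obtain x y where xy: "e = {x, y}" by (auto simp: card_2_iff)
    then have V: "x \<in> ?V" "y \<in> ?V" using fin_graph_edgeD[OF G] e by auto
    show "e \<in> ?E1 \<union> ?E2"
    proof (cases "x \<in> B \<or> y \<in> B")
      case True
      then show ?thesis using V xy by (auto simp: image_iff doubleton_eq_iff)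
    next
      case False
      then have "e \<in> ?E2" using V xy e t by (intro UN_I[of x] UN_I[of "t y"]) auto
      then show ?thesis by blast
    qed
  qed
  then have "card (edges G) \<le> card (?E1 \<union> ?E2)"
    by (rule card_mono[rotated]) (use finV finB in auto)
  also have "\<dots> \<le> card ?E1 + card ?E2" by (rule card_Un_le)
  also have "card ?E1 \<le> card ?V * card B"
    using card_image_le[of "?V \<times> B" "\<lambda>(x, y). {x, y}"] finV finB by (simp add: card_cartesian_product)
  also have "card ?E2 \<le> (\<Sum>b\<in>?V - B. card (\<Union>j<L. (\<lambda>y. {b, y}) ` ?N b j))"
    by (rule card_UN_le) (use finV in simp)
  also have "\<dots> \<le> (\<Sum>b\<in>?V - B. L * d)"
  proof (rule sum_mono)
    fix b assume b: "b \<in> ?V - B"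
    have "card (\<Union>j<L. (\<lambda>y. {b, y}) ` ?N b j) \<le> (\<Sum>j<L. card ((\<lambda>y. {b, y}) ` ?N b j))"
      by (rule card_UN_le) simp
    also have "\<dots> \<le> (\<Sum>j<L. d)"
    proof (rule sum_mono)
      fix j assume "j \<in> {..<L}"
      then have "card (?N b j) \<le> d" using few[OF b] by simp
      moreover have "card ((\<lambda>y. {b, y}) ` ?N b j) \<le> card (?N b j)"
        by (rule card_image_le) (use finV in simp)
      ultimately show "card ((\<lambda>y. {b, y}) ` ?N b j) \<le> d" by linarith
    qed
    finally show "card (\<Union>j<L. (\<lambda>y. {b, y}) ` ?N b j) \<le> L * d" by simp
  qed
  also have "\<dots> \<le> card ?V * (L * d)"
    using card_mono[OF finV, of "?V - B"] by auto
  finally show ?thesis by (simp add: algebra_simps)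
qed

text \<open>The joining property is all that is asked of \<open>G\<close>. The bound
  \<open>Suc (v + 2 * card Q)\<close> allows for the largest set to which it is applied: one vertex
  \<open>b\<close>, \<open>v\<close> of its neighbours and two whole columns.\<close>

lemma sat_le_of_joined_columns:
  fixes F :: "'a graph" and G :: "'b graph"
  assumes F: "fin_graph F"
    and nofit: "\<not> (\<exists>c l. fits F r s a c l)"
    and fit: "fits F r s (Suc a) c l" and lR: "\<And>x. x \<in> verts F \<Longrightarrow> l x < R"
    and v: "v = card (verts F)" and Q: "Q = column_roles r s a v R"
    and G: "fin_graph G"
    and D: "\<And>j. j < L \<Longrightarrow> D j \<subseteq> verts G" "\<And>j. j < L \<Longrightarrow> card (D j) = card Q"
      "disjoint_family_on D {..<L}"
    and join: "\<And>U. U \<subseteq> verts G \<Longrightarrow> card U \<le> Suc (v + 2 * card Q) \<Longrightarrow>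
      \<exists>j<L. joined_column (edges G) (D j) U"
  shows "sat G F \<le> card (verts G) * (L * (card Q + v))"
proof -
  let ?V = "verts G"
  have finV: "finite ?V" and finVF: "finite (verts F)" using G F by (auto simp: fin_graph_def)
  have finQ: "finite Q" by (simp add: Q)
  have finD: "finite (D j)" if "j < L" for j using D(1)[OF that] finV by (rule finite_subset)
  have "\<exists>g. bij_betw g Q (D j)" if "j < L" for j
    using finite_same_card_bij[OF finQ finD[OF that]] D(2)[OF that] by simp
  then obtain g where g: "\<And>j. j < L \<Longrightarrow> bij_betw (g j) Q (D j)" by metis
  define B where "B = (\<Union>j<L. D j)"
  have BV: "B \<subseteq> ?V" using D(1) by (auto simp: B_def)
  have gD: "g j q \<in> D j" if "j < L" "q \<in> Q" for j q
    using bij_betwE[OF g[OF that(1)]] that(2) by blast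
  have gB: "g j q \<in> B" if "j < L" "q \<in> Q" for j q
    using gD[OF that] that(1) by (auto simp: B_def)
  have ginj: "inj_on (\<lambda>(j, q). g j q) ({..<L} \<times> Q)"
  proof (rule inj_onI)
    fix z z' assume A: "z \<in> {..<L} \<times> Q" "z' \<in> {..<L} \<times> Q"
      "(case z of (j, q) \<Rightarrow> g j q) = (case z' of (j, q) \<Rightarrow> g j q)"
    obtain j q j' q' where z: "z = (j, q)" "z' = (j', q')" by (metis surj_pair)
    have "j = j'"
      using A z gD[of j q] gD[of j' q'] D(3) by (fastforce simp: disjoint_family_on_def)
    with A z show "z = z'"
      using bij_betw_imp_inj_on[OF g[of j]] by (auto simp: inj_on_def)
  qed
  define P where "P = inv_into ({..<L} \<times> Q) (\<lambda>(j, q). g j q)"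
  have Pg: "P (g j q) = (j, q)" if "j < L" "q \<in> Q" for j q
    using inv_into_f_f[OF ginj, of "(j, q)"] that by (simp add: P_def)
  have Bcase: "\<exists>j q. j < L \<and> q \<in> Q \<and> y = g j q" if "y \<in> B" for y
    using that bij_betw_imp_surj_on[OF g] unfolding B_def by blast
  \<comment> \<open>The empty \<open>U\<close> yields a column that is a clique and can hold the
    reserved pieces; singletons yield the column to which each vertex is attached.\<close>
  obtain j0 where j0: "j0 < L" "joined_column (edges G) (D j0) {}"
    using join[of "{}"] by auto
  have "\<exists>j<L. joined_column (edges G) (D j) {y}" if "y \<in> ?V" for y
    using join[of "{y}"] that by simp
  then obtain t where t: "\<And>y. y \<in> ?V \<Longrightarrow> t y < L"
      "\<And>y. y \<in> ?V \<Longrightarrow> joined_column (edges G) (D (t y)) {y}" by metis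

  \<comment> \<open>\<open>C\<close> and \<open>M\<close> are the colour and the label of the host structure on \<open>G\<close>.\<close>
  define C where "C y = (if y \<in> B then
      (case P y of (j, h, i, u) \<Rightarrow> if h = 0 then i else if h = 1 then r else if j = j0 \<and> h = 2 then r else Suc r)
      else Suc r)" for y
  define M where "M y = (if y \<in> B then
      (case P y of (j, h, i, u) \<Rightarrow> if h = 1 then R + j else if j = j0 then i else R)
      else R + t y)" for y
  have CA: "C (g j (0, i, u)) = i" if "j < L" "i < r" "u < v" for j i u
    using that gB[of j] Pg[of j] by (simp add: C_def Q)
  have CT: "C (g j (Suc 0, 0, u)) = r" "M (g j (Suc 0, 0, u)) = R + j" if "j < L" "u < s" for j u
    using that gB[of j] Pg[of j] by (simp_all add: C_def M_def Q)
  have CX: "C (g j0 (2, i, u)) = r" "M (g j0 (2, i, u)) = i" if "i < R" "u < s + of_bool (i < a)" for i u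
    using that gB[of j0] Pg[of j0] j0 by (simp_all add: C_def M_def Q)
  have CY: "C (g j0 (3, i, u)) = Suc r" "M (g j0 (3, i, u)) = i" if "i < R" "u < v" for i u
    using that gB[of j0] Pg[of j0] j0 by (simp_all add: C_def M_def Q)
  have CN: "C y = Suc r" "M y = R + t y" if "y \<notin> B" for y
    using that by (simp_all add: C_def M_def)
  \<comment> \<open>Only colour \<open>r\<close> is limited in size, so it suffices to locate its
    vertices: the \<open>s\<close>-sets of the columns and the small sides of the reserved
    pieces.\<close>
  have Cr: "(\<exists>j u. j < L \<and> u < s \<and> y = g j (Suc 0, 0, u)) \<or>
      (\<exists>i u. i < R \<and> u < s + of_bool (i < a) \<and> y = g j0 (2, i, u))" if "C y = r" for y
  proof -
    have "y \<in> B" using that by (auto simp: C_def split: if_splits)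
    then obtain j q where jq: "j < L" "q \<in> Q" "y = g j q" using Bcase by blast
    have "C y = (case (j, q) of (j, h, i, u) \<Rightarrow>
        if h = 0 then i else if h = 1 then r else if j = j0 \<and> h = 2 then r else Suc r)"
      using \<open>y \<in> B\<close> jq Pg by (simp add: C_def)
    with that have C': "(case (j, q) of (j, h, i, u) \<Rightarrow>
        if h = 0 then i else if h = 1 then r else if j = j0 \<and> h = 2 then r else Suc r) = r" by simp
    from jq(2) show ?thesis
      unfolding Q
    proof (cases rule: column_roles_cases)
      case (A i u) then show ?thesis using C' by simp
    next
      case (T u) then show ?thesis using jq by blast
    next
      case (X i u)
      then have "j = j0" using C' by (simp split: if_splits)
      with X show ?thesis using jq by blast
    next
      case (Y i u) then show ?thesis using C' by simp
    qed
  qed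
  have Cle: "C y \<le> Suc r" for y
  proof (cases "y \<in> B")
    case True
    then obtain j q where jq: "j < L" "q \<in> Q" "y = g j q" using Bcase by blast
    from jq(2) show ?thesis
      unfolding Q
      by (cases rule: column_roles_cases) (use True jq Pg in \<open>auto simp: C_def\<close>)
  qed (simp add: CN)

  \<comment> \<open>\<open>E0\<close> takes every edge of \<open>G\<close> that colours and labels
    allow, so the edge conditions of the fit hold by construction and only the small sides have to
    be counted.\<close>
  define E0 where "E0 = {e \<in> edges G. \<forall>x y. e = {x, y} \<longrightarrow>
      C x \<noteq> C y \<and> (r \<le> C x \<longrightarrow> r \<le> C y \<longrightarrow> M x = M y)}"
  have E0I: "{x, y} \<in> E0" if "{x, y} \<in> edges G" "C x \<noteq> C y" "r \<le> C x \<Longrightarrow> r \<le> C y \<Longrightarrow> M x = M y" for x y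
    using that by (auto simp: E0_def doubleton_eq_iff)
  have "fits (?V, E0) r s a C M"
    unfolding fits_def
  proof (intro conjI ballI allI impI)
    fix i
    show "card {x \<in> verts (?V, E0). C x = r \<and> M x = i} \<le> s + of_bool (i < a)"
    \<comment> \<open>On colour \<open>r\<close>, labels below \<open>R\<close> name reserved pieces
      in \<open>j0\<close>, and \<open>R + j\<close> names the piece of column \<open>j\<close>.
      Positions that receive the default label \<open>R\<close> never have colour
      \<open>r\<close>.\<close>
    proof (cases "i < R")
      case True
      have "{x \<in> verts (?V, E0). C x = r \<and> M x = i} \<subseteq> (\<lambda>u. g j0 (2, i, u)) ` {..<s + of_bool (i < a)}"
      proof
        fix x assume "x \<in> {x \<in> verts (?V, E0). C x = r \<and> M x = i}"
        then have x: "C x = r" "M x = i" by auto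
        from Cr[OF x(1)] show "x \<in> (\<lambda>u. g j0 (2, i, u)) ` {..<s + of_bool (i < a)}"
        proof (elim disjE exE conjE)
          fix j u assume "j < L" "u < s" "x = g j (Suc 0, 0, u)"
          then show ?thesis using CT(2)[of j u] x True by simp
        next
          fix i' u assume A: "i' < R" "u < s + of_bool (i' < a)" "x = g j0 (2, i', u)"
          then have "i' = i" using CX(2)[OF A(1,2)] x by simp
          with A show ?thesis by blast
        qed
      qed
      then have "card {x \<in> verts (?V, E0). C x = r \<and> M x = i} \<le> card {..<s + of_bool (i < a)}"
        by (meson card_image_le card_mono finite_imageI finite_lessThan le_trans)
      then show ?thesis by simp
    next
      case False
      have "{x \<in> verts (?V, E0). C x = r \<and> M x = i} \<subseteq> (\<lambda>u. g (i - R) (Suc 0, 0, u)) ` {..<s}"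
      proof
        fix x assume "x \<in> {x \<in> verts (?V, E0). C x = r \<and> M x = i}"
        then have x: "C x = r" "M x = i" by auto
        from Cr[OF x(1)] show "x \<in> (\<lambda>u. g (i - R) (Suc 0, 0, u)) ` {..<s}"
        proof (elim disjE exE conjE)
          fix j u assume A: "j < L" "u < s" "x = g j (Suc 0, 0, u)"
          then have "i - R = j" using CT(2)[of j u] x by simp
          with A show ?thesis by blast
        next
          fix i' u assume A: "i' < R" "u < s + of_bool (i' < a)" "x = g j0 (2, i', u)"
          then show ?thesis using CX(2)[OF A(1,2)] x False by simp
        qed
      qed
      then have "card {x \<in> verts (?V, E0). C x = r \<and> M x = i} \<le> card {..<s}"
        by (meson card_image_le card_mono finite_imageI finite_lessThan le_trans)
      then show ?thesis by simp
    qed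
  qed (auto simp: E0_def Cle)
  then have "\<not> contains_copy (?V, E0) F"
    using fits_pullback[of "(?V, E0)" r s a C M F] nofit finV by auto
  moreover have "E0 \<subseteq> edges G" by (auto simp: E0_def)
  ultimately obtain E where E: "E0 \<subseteq> E" "saturated_in (?V, E) G F"
    using saturated_extension[OF G] by blast
  have H: "fin_graph (?V, E)" and free: "\<not> contains_copy (?V, E) F"
    using E(2) by (auto simp: saturated_in_def subgraph_def)

  have few: "card {y \<in> ?V - B. t y = j \<and> {b, y} \<in> E} \<le> v" if b: "b \<in> ?V - B" and j: "j < L" for b j
  proof (rule ccontr)
    assume "\<not> ?thesis"
    then obtain N where N: "N \<subseteq> {y \<in> ?V - B. t y = j \<and> {b, y} \<in> E}" "card N = v" "finite N"
      using obtain_subset_with_card_n[of v "{y \<in> ?V - B. t y = j \<and> {b, y} \<in> E}"] by auto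
    have NV: "y \<in> ?V" "y \<notin> B" "t y = j" "{b, y} \<in> E" "y \<noteq> b" if "y \<in> N" for y
      using N(1) that fin_graph_edgeD[OF H, of b y] by auto
    \<comment> \<open>All vertices used for the colours \<open>r\<close> and \<open>Suc r\<close>
      lie in \<open>U\<close>, so one column \<open>j1\<close> joined to \<open>U\<close> supplies
      the colours below \<open>r\<close> for the whole copy.\<close>
    define U where "U = insert b (N \<union> D j \<union> D j0)"
    have "card U \<le> Suc (v + 2 * card Q)"
    proof -
      have "card (N \<union> D j \<union> D j0) \<le> card N + card (D j) + card (D j0)"
        by (meson add_le_mono card_Un_le le_refl le_trans)
      then show ?thesis
        using N(2) D(2)[OF j] D(2)[OF j0(1)] card_insert_le_m1[of "Suc (v + 2 * card Q)" "N \<union> D j \<union> D j0" b]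
        by (simp add: U_def)
    qed
    moreover have UV: "U \<subseteq> ?V"
      using b N(1) D(1)[OF j] D(1)[OF j0(1)] by (auto simp: U_def)
    ultimately obtain j1 where j1: "j1 < L" "joined_column (edges G) (D j1) U"
      using join by blast
    \<comment> \<open>Piece \<open>a\<close> of the fit is realised by \<open>b\<close>, the \<open>s\<close>-set of column \<open>j\<close> and \<open>N\<close>.\<close>
    define S where "S = (\<lambda>(h, i).
        if h < r then (\<lambda>u. g j1 (0, h, u)) ` {..<v}
        else if h = r then
          (if i = a then insert b ((\<lambda>u. g j (Suc 0, 0, u)) ` {..<s})
           else (\<lambda>u. g j0 (2, i, u)) ` {..<s + of_bool (i < a)})
        else if i = a then N else (\<lambda>u. g j0 (3, i, u)) ` {..<v})"
    define k where "k x = (c x, if c x < r then 0 else l x)" for x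
    \<comment> \<open>\<open>m\<close> overrides \<open>C\<close> and \<open>M\<close> on
      \<open>b\<close>, the \<open>s\<close>-set of column \<open>j\<close> and \<open>N\<close>: in
      the host their labels are at least \<open>R\<close>, and \<open>b\<close> has colour
      \<open>Suc r\<close>, while the copy uses them as piece \<open>a\<close>.\<close>
    define m where "m y = (if y = b \<or> y \<in> (\<lambda>u. g j (Suc 0, 0, u)) ` {..<s} then (r, a)
        else if y \<in> N then (Suc r, a) else (C y, if C y < r then 0 else M y))" for y
    have cle: "c x \<le> Suc r" if "x \<in> verts F" for x using fitsD(1)[OF fit that] .
    have notb: "g i q \<noteq> b" "g i q \<notin> N" if "i < L" "q \<in> Q" for i q
      using gB[OF that] b NV(2) by auto
    have notT: "g i q \<notin> (\<lambda>u. g j (Suc 0, 0, u)) ` {..<s}" if "i < L" "q \<in> Q" "fst q \<noteq> Suc 0" for i q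
      using Pg[OF that(1,2)] Pg[OF j] that(3) by (auto simp: Q)
    have Tb: "g j (Suc 0, 0, u) \<noteq> b" "g j (Suc 0, 0, u) \<notin> N" if "u < s" for u
      using notb[OF j, of "(Suc 0, 0, u)"] that by (simp_all add: Q)
    have injq: "card ((\<lambda>u. g i (h, h', u)) ` {..<n}) = n" if "i < L" "\<And>u. u < n \<Longrightarrow> (h, h', u) \<in> Q" for i h h' n
      by (subst card_image) (use that Pg in \<open>auto intro!: inj_onI dest!: arg_cong[where f = P]\<close>)
    have "\<exists>f. inj_on f (verts F) \<and> (\<forall>x\<in>verts F. f x \<in> S (k x))"
    proof (rule classwise_injection[where m = m])
      fix x assume x: "x \<in> verts F"
      consider "c x < r" | "c x = r" | "c x = Suc r" using cle[OF x] by linarith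
      note cases = this
      show "finite (S (k x))" using N(3) by (simp add: S_def k_def)
      have le_v: "card {y \<in> verts F. k y = k x} \<le> v"
        unfolding v by (rule card_mono) (use finVF in auto)
      have "card {y \<in> verts F. k y = k x} \<le> card (S (k x))" if "c x < r"
      proof -
        have "card (S (k x)) = v" using that injq[OF j1(1)] by (simp add: S_def k_def Q)
        with le_v show ?thesis by simp
      qed
      moreover have "card {y \<in> verts F. k y = k x} \<le> card (S (k x))" if "c x = Suc r"
      proof -
        have "card (S (k x)) = v" using that N(2) injq[OF j0(1)] lR[OF x] by (simp add: S_def k_def Q)
        with le_v show ?thesis by simp
      qed
      \<comment> \<open>Passing from \<open>a\<close> to \<open>Suc a\<close> adds a place only at
        label \<open>a\<close>; there \<open>b\<close> is the additional vertex beside the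
        \<open>s\<close>-set of column \<open>j\<close>.\<close>
      moreover have "card {y \<in> verts F. k y = k x} \<le> card (S (k x))" if cx: "c x = r"
      proof -
        have "{y \<in> verts F. k y = k x} = {y \<in> verts F. c y = r \<and> l y = l x}"
          using cx by (auto simp: k_def)
        then have le: "card {y \<in> verts F. k y = k x} \<le> s + of_bool (l x < Suc a)"
          using fitsD(4)[OF fit, of "l x"] by simp
        show ?thesis
        proof (cases "l x = a")
          case True
          have "b \<notin> (\<lambda>u. g j (Suc 0, 0, u)) ` {..<s}"
            using Tb(1) by auto
          then have "card (S (k x)) = Suc s"
            using True cx injq[OF j, of s "Suc 0" 0] by (simp add: S_def k_def Q)
          with le True show ?thesis by simp
        next
          case False
          then have "card (S (k x)) = s + of_bool (l x < a)"
            using cx injq[OF j0(1), of "s + of_bool (l x < a)" 2 "l x"] lR[OF x] by (simp add: S_def k_def Q)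
          with le False show ?thesis by (simp add: less_Suc_eq)
        qed
      qed
      ultimately show "card {y \<in> verts F. k y = k x} \<le> card (S (k x))" using cases by blast
      fix y assume y: "y \<in> S (k x)"
      show "m y = k x"
      proof (cases rule: cases)
        case 1
        then obtain u where u: "u < v" "y = g j1 (0, c x, u)" using y by (auto simp: S_def k_def)
        then have "y \<noteq> b" "y \<notin> N" "y \<notin> (\<lambda>u. g j (Suc 0, 0, u)) ` {..<s}"
          using notb[OF j1(1), of "(0, c x, u)"] notT[OF j1(1), of "(0, c x, u)"] 1 by (auto simp: Q)
        then show ?thesis using 1 u CA[OF j1(1)] by (simp add: m_def k_def)
      next
        case 2
        show ?thesis
        proof (cases "l x = a")
          case True
          then show ?thesis using 2 y by (auto simp: S_def k_def m_def)
        next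
          case False
          with 2 y obtain u where u: "u < s + of_bool (l x < a)" "y = g j0 (2, l x, u)"
            by (auto simp: S_def k_def)
          then have "y \<noteq> b" "y \<notin> N" "y \<notin> (\<lambda>u. g j (Suc 0, 0, u)) ` {..<s}"
            using notb[OF j0(1), of "(2, l x, u)"] notT[OF j0(1), of "(2, l x, u)"] lR[OF x] by (auto simp: Q)
          then show ?thesis using 2 u CX lR[OF x] by (simp add: m_def k_def)
        qed
      next
        case 3
        show ?thesis
        proof (cases "l x = a")
          case True
          then have "y \<in> N" using 3 y by (simp add: S_def k_def)
          moreover have "y \<noteq> b" "y \<notin> (\<lambda>u. g j (Suc 0, 0, u)) ` {..<s}"
            using NV(5)[OF \<open>y \<in> N\<close>] Tb(2) \<open>y \<in> N\<close> by auto
          ultimately show ?thesis using 3 True by (simp add: m_def k_def)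
        next
          case False
          with 3 y obtain u where u: "u < v" "y = g j0 (3, l x, u)"
            by (auto simp: S_def k_def)
          then have "y \<noteq> b" "y \<notin> N" "y \<notin> (\<lambda>u. g j (Suc 0, 0, u)) ` {..<s}"
            using notb[OF j0(1), of "(3, l x, u)"] notT[OF j0(1), of "(3, l x, u)"] lR[OF x] by (auto simp: Q)
          then show ?thesis using 3 u CY lR[OF x] by (simp add: m_def k_def)
        qed
      qed
    qed (use finVF in simp)
    then obtain f where f: "inj_on f (verts F)" "\<And>x. x \<in> verts F \<Longrightarrow> f x \<in> S (k x)" by blast
    have low: "f x \<in> D j1 \<and> C (f x) = c x" if "x \<in> verts F" "c x < r" for x
      using f(2)[OF that(1)] that(2) gD[OF j1(1)] CA[OF j1(1)] by (auto simp: S_def k_def Q)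
    have high: "f x \<in> U \<and> r \<le> C (f x)" if x: "x \<in> verts F" "\<not> c x < r" for x
    proof -
      have "f x \<in> S (c x, l x)" using f(2)[OF x(1)] x(2) by (simp add: k_def)
      moreover have "c x = r \<or> c x = Suc r" using cle[OF x(1)] x(2) by linarith
      ultimately show ?thesis
        using gD[OF j] gD[OF j0(1)] CT(1)[OF j] CX(1) CY(1) CN(1) b NV(2) lR[OF x(1)]
        by (auto simp: S_def U_def Q split: if_splits)
    qed
    have inV: "f x \<in> ?V" if "x \<in> verts F" for x
      using low[OF that] high[OF that] UV D(1)[OF j1(1)] by blast
    \<comment> \<open>Orienting by colour leaves three sources of edges: column \<open>j1\<close>
      joined to \<open>U\<close>, piece \<open>a\<close>, and the clique \<open>D j0\<close>. Only
      the edges from \<open>b\<close> to \<open>N\<close> use the assumption on \<open>b\<close>;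
      all others already lie in \<open>E0\<close>.\<close>
    have edge: "{f x, f y} \<in> E" if e: "{x, y} \<in> edges F" and lt: "c x < c y" for x y
    proof -
      note xy = fin_graph_edgeD[OF F e]
      have ne: "f x \<noteq> f y" using f(1) xy by (auto simp: inj_on_def)
      show ?thesis
      proof (cases "c x < r")
        case True
        have y: "f y \<in> D j1 \<union> U" using low[OF xy(2)] high[OF xy(2)] by blast
        have "{f x, f y} \<in> edges G"
          using j1(2) low[OF xy(1) True] y ne unfolding joined_column_def by blast
        moreover have "C (f x) < C (f y)"
          using low[OF xy(1) True] low[OF xy(2)] high[OF xy(2)] lt True by (cases "c y < r") auto
        ultimately have "{f x, f y} \<in> E0"
          using low[OF xy(1) True] True by (intro E0I) auto
        then show ?thesis using E(1) by blast
      next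
        case False
        then have cxy: "c x = r" "c y = Suc r" using lt cle[OF xy(2)] by linarith+
        then have lxy: "l y = l x" using fitsD(3)[OF fit e] by simp
        have fxy: "f x \<in> S (r, l x)" "f y \<in> S (Suc r, l x)"
          using f(2)[OF xy(1)] f(2)[OF xy(2)] cxy lxy by (simp_all add: k_def)
        show ?thesis
        proof (cases "l x = a")
          case True
          then have fy: "f y \<in> N" using fxy by (simp add: S_def)
          from fxy True consider "f x = b" | u where "u < s" "f x = g j (Suc 0, 0, u)"
            by (auto simp: S_def)
          then show ?thesis
          proof cases
            case 1
            then show ?thesis using NV(4)[OF fy] by simp
          next
            case 2
            have "f x \<in> D j" using gD[OF j] 2 by (simp add: Q)
            then have "{f x, f y} \<in> edges G"
              using t(2)[OF NV(1)[OF fy]] NV(3)[OF fy] ne unfolding joined_column_def by blast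
            then have "{f x, f y} \<in> E0"
              by (rule E0I) (use 2 CT[OF j] CN[OF NV(2)[OF fy]] NV(3)[OF fy] in auto)
            then show ?thesis using E(1) by blast
          qed
        next
          case False
          from fxy False obtain u where u: "u < s + of_bool (l x < a)" "f x = g j0 (2, l x, u)"
            by (auto simp: S_def)
          from fxy False obtain w where w: "w < v" "f y = g j0 (3, l x, w)"
            by (auto simp: S_def)
          have "f x \<in> D j0" "f y \<in> D j0"
            using gD[OF j0(1)] u w lR[OF xy(1)] by (simp_all add: Q)
          then have "{f x, f y} \<in> edges G"
            using j0(2) ne unfolding joined_column_def by blast
          then have "{f x, f y} \<in> E0"
            by (rule E0I) (use u w CX CY lR[OF xy(1)] in auto)
          then show ?thesis using E(1) by blast
        qed
      qed
    qed
    have "contains_copy (?V, E) F"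
      unfolding contains_copy_def
    proof (intro exI[of _ f] conjI ballI)
      show "f ` verts F \<subseteq> verts (?V, E)" using inV by auto
      fix e assume e: "e \<in> edges F"
      then have "card e = 2" using F by (auto simp: fin_graph_def nsets_def)
      then obtain x y where xy: "e = {x, y}" by (auto simp: card_2_iff)
      then have "c x \<noteq> c y" using fitsD(2)[OF fit] e by blast
      then have "{f x, f y} \<in> E"
        using edge[of x y] edge[of y x] e xy by (auto simp: insert_commute linorder_neq_iff)
      then show "f ` e \<in> edges (?V, E)" using xy by simp
    qed (rule f(1))
    with free show False by blast
  qed
  have "card E \<le> card ?V * (card B + L * v)"
    using card_edges_le[OF H, of B L t v] BV few t(1) by simp
  also have "card B \<le> L * card Q"
  proof -
    have "card B \<le> (\<Sum>j<L. card (D j))" unfolding B_def by (rule card_UN_le) simp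
    also have "\<dots> = L * card Q" using D(2) by simp
    finally show ?thesis .
  qed
  finally have "card E \<le> card ?V * (L * (card Q + v))" by (simp add: algebra_simps)
  moreover have "sat G F \<le> card E"
    unfolding sat_def by (rule Least_le) (use E(2) in auto)
  ultimately show ?thesis by linarith
qed

section \<open>Joined columns in the random graph\<close>

text \<open>Intersecting with the supports makes both factors countable without changing any of the
  probabilities.\<close>

lemma prob_pair_pmf_Times:
  "measure_pmf.prob (pair_pmf M N) (A \<times> B) = measure_pmf.prob M A * measure_pmf.prob N B"
proof -
  have "measure_pmf.prob (pair_pmf M N) (A \<times> B) =
        measure_pmf.prob (pair_pmf M N) ((A \<inter> set_pmf M) \<times> (B \<inter> set_pmf N))"
    by (subst (1 2) measure_Int_set_pmf[symmetric]) (auto intro!: arg_cong[where f = "measure_pmf.prob _"])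
  also have "\<dots> = measure_pmf.prob M (A \<inter> set_pmf M) * measure_pmf.prob N (B \<inter> set_pmf N)"
    by (intro measure_pmf_prob_product countable_Int2 countable_set_pmf)
  finally show ?thesis by (simp add: measure_Int_set_pmf)
qed

text \<open>Disjoint blocks are independent. Each induction step splits the product distribution
  into the coordinates in \<open>S j\<close> and the rest, so \<open>I\<close> must be allowed to
  vary.\<close>

lemma prob_no_block_present:
  fixes p :: real
  assumes p: "0 \<le> p" "p \<le> 1" and "finite J" and "finite I"
    and "disjoint_family_on S J" and "\<And>j. j \<in> J \<Longrightarrow> S j \<subseteq> I"
  shows "measure_pmf.prob (Pi_pmf I False (\<lambda>_. bernoulli_pmf p)) {X. \<forall>j\<in>J. \<exists>e\<in>S j. \<not> X e} =
         (\<Prod>j\<in>J. 1 - p ^ card (S j))"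
  using assms(3-6)
proof (induction J arbitrary: I rule: finite_induct)
  case empty
  then show ?case by simp
next
  case (insert j J)
  let ?Q = "\<lambda>I. Pi_pmf I False (\<lambda>_. bernoulli_pmf p)"
  have S: "S j \<subseteq> I" "finite (S j)"
    using insert.prems by (auto intro: finite_subset)
  have disj: "S i \<inter> S j = {}" if "i \<in> J" for i
    using insert.prems(2) insert.hyps(2) that by (auto simp: disjoint_family_on_def)
  have "measure_pmf.prob (?Q (S j)) {X. \<forall>e\<in>S j. X e} = p ^ card (S j)"
  proof -
    have "{X. \<forall>e\<in>S j. X e} = Pi (S j) (\<lambda>_. {True})" by auto
    then show ?thesis
      using S(2) p by (simp add: measure_Pi_pmf_Pi measure_pmf_single)
  qed
  moreover have "{X. \<exists>e\<in>S j. \<not> X e} = space (measure_pmf (?Q (S j))) - {X. \<forall>e\<in>S j. X e}" by auto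
  ultimately have one: "measure_pmf.prob (?Q (S j)) {X. \<exists>e\<in>S j. \<not> X e} = 1 - p ^ card (S j)"
    by (simp only:) (subst measure_pmf.prob_compl, auto)
  have rest: "measure_pmf.prob (?Q (I - S j)) {X. \<forall>i\<in>J. \<exists>e\<in>S i. \<not> X e} =
      (\<Prod>i\<in>J. 1 - p ^ card (S i))"
  proof (rule insert.IH)
    show "finite (I - S j)" using insert.prems by simp
    show "disjoint_family_on S J"
      using insert.prems(2) by (auto simp: disjoint_family_on_def)
    show "S i \<subseteq> I - S j" if "i \<in> J" for i
      using insert.prems(3)[of i] disj[OF that] that by auto
  qed
  have I: "I = S j \<union> (I - S j)" using S by auto
  have "?Q I = map_pmf (\<lambda>(f, g) x. if x \<in> S j then f x else g x)
      (pair_pmf (?Q (S j)) (?Q (I - S j)))"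
    by (subst I, rule Pi_pmf_union) (use S insert.prems in auto)
  moreover have "(\<lambda>(f, g) x. if x \<in> S j then f x else g x) -` {X. \<forall>i\<in>insert j J. \<exists>e\<in>S i. \<not> X e} =
      {X. \<exists>e\<in>S j. \<not> X e} \<times> {X. \<forall>i\<in>J. \<exists>e\<in>S i. \<not> X e}"
  proof -
    have 1: "(\<exists>e\<in>S j. \<not> (if e \<in> S j then f e else g e)) \<longleftrightarrow> (\<exists>e\<in>S j. \<not> f e)" for f g :: "'b \<Rightarrow> bool"
      by (rule bex_cong) auto
    have 2: "(\<forall>i\<in>J. \<exists>e\<in>S i. \<not> (if e \<in> S j then f e else g e)) \<longleftrightarrow> (\<forall>i\<in>J. \<exists>e\<in>S i. \<not> g e)"
      for f g :: "'b \<Rightarrow> bool"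
      using disj by (intro ball_cong bex_cong) auto
    show ?thesis
    proof (rule set_eqI)
      fix z :: "('b \<Rightarrow> bool) \<times> ('b \<Rightarrow> bool)"
      obtain f g where z: "z = (f, g)" by (cases z)
      show "z \<in> (\<lambda>(f, g) x. if x \<in> S j then f x else g x) -` {X. \<forall>i\<in>insert j J. \<exists>e\<in>S i. \<not> X e} \<longleftrightarrow>
          z \<in> {X. \<exists>e\<in>S j. \<not> X e} \<times> {X. \<forall>i\<in>J. \<exists>e\<in>S i. \<not> X e}"
        unfolding z vimage_def mem_Collect_eq prod.case mem_Times_iff fst_conv snd_conv
        using 1[of f g] 2[of f g] by blast
    qed
  qed
  ultimately show ?case
    using insert.hyps by (simp add: prob_pair_pmf_Times one rest)
qed

text \<open>At most \<open>u\<close> columns meet \<open>U\<close>, since columns are disjoint;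
  these are discarded. For the others, the sets \<open>S j\<close> of required pairs are disjoint,
  because each pair contains a vertex of its own column, which lies neither in another column nor in
  \<open>U\<close>. Hence the failures are independent, and each \<open>S j\<close> has at most
  \<open>c * (c + u)\<close> pairs.\<close>

lemma prob_no_joined_column:
  fixes p :: real
  assumes p: "0 \<le> p" "p \<le> 1" and U: "U \<subseteq> {1..n}" "card U \<le> u"
    and D: "\<And>j. j < L \<Longrightarrow> D j \<subseteq> {1..n}" "\<And>j. j < L \<Longrightarrow> card (D j) = c" "disjoint_family_on D {..<L}"
  shows "measure_pmf.prob (gnp n p) {G. \<forall>j<L. \<not> joined_column (edges G) (D j) U}
         \<le> (1 - p ^ (c * (c + u))) ^ (L - u)"
proof -
  define J where "J = {j. j < L \<and> D j \<inter> U = {}}"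
  define S where "S j = {e. \<exists>x\<in>D j. \<exists>y\<in>D j \<union> U. x \<noteq> y \<and> e = {x, y}}" for j
  have finU: "finite U" using U(1) by (rule finite_subset) simp
  have finD: "finite (D j)" if "j < L" for j using D(1)[OF that] by (rule finite_subset) simp
  have finJ: "finite J" by (simp add: J_def)
  have SI: "S j \<subseteq> nsets {1..n} 2" if "j \<in> J" for j
    using D(1)[of j] U(1) that by (auto simp: S_def J_def simp del: atLeastAtMost_iff One_nat_def)
  have disj: "disjoint_family_on S J"
  proof (unfold disjoint_family_on_def, intro ballI impI equals0I)
    fix i j e assume ij: "i \<in> J" "j \<in> J" "i \<noteq> j" and e: "e \<in> S i \<inter> S j"
    from e obtain x where "x \<in> e" "x \<in> D i" by (auto simp: S_def)
    moreover have "e \<subseteq> D j \<union> U" using IntD2[OF e] by (auto simp: S_def)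
    moreover have "D i \<inter> D j = {}" "D i \<inter> U = {}"
      using ij D(3) by (auto simp: J_def disjoint_family_on_def)
    ultimately show False by blast
  qed
  have cardS: "card (S j) \<le> c * (c + u)" if "j \<in> J" for j
  proof -
    have j: "j < L" using that by (simp add: J_def)
    have "S j \<subseteq> (\<lambda>(x, y). {x, y}) ` (D j \<times> (D j \<union> U))" by (auto simp: S_def)
    then have "card (S j) \<le> card (D j \<times> (D j \<union> U))"
      using finD[OF j] finU by (meson card_image_le card_mono finite_SigmaI finite_UnI finite_imageI le_trans)
    also have "\<dots> = c * card (D j \<union> U)" by (simp add: card_cartesian_product D(2)[OF j])
    also have "\<dots> \<le> c * (c + u)"
      using card_Un_le[of "D j" U] U(2) D(2)[OF j] by (intro mult_left_mono) auto
    finally show ?thesis .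
  qed
  have cardJ: "L - u \<le> card J"
  proof -
    define w where "w j = (SOME x. x \<in> D j \<inter> U)" for j
    have w: "w j \<in> D j \<inter> U" if "j \<in> {..<L} - J" for j
      unfolding w_def by (rule someI_ex) (use that in \<open>auto simp: J_def\<close>)
    have "card ({..<L} - J) \<le> card U"
    proof (rule card_inj_on_le)
      show "inj_on w ({..<L} - J)"
      proof (rule inj_onI)
        fix i j assume "i \<in> {..<L} - J" "j \<in> {..<L} - J" "w i = w j"
        then show "i = j"
          using w[of i] w[of j] D(3) by (fastforce simp: disjoint_family_on_def)
      qed
    qed (use w finU in auto)
    moreover have "card ({..<L} - J) = L - card J"
      using finJ by (subst card_Diff_subset) (auto simp: J_def)
    ultimately show ?thesis using U(2) by linarith
  qed
  have "measure_pmf.prob (gnp n p) {G. \<forall>j<L. \<not> joined_column (edges G) (D j) U} \<le>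
        measure_pmf.prob (Pi_pmf (nsets {1..n} 2) False (\<lambda>_. bernoulli_pmf p)) {X. \<forall>j\<in>J. \<exists>e\<in>S j. \<not> X e}"
    unfolding gnp_def measure_map_pmf
  proof (rule measure_pmf.finite_measure_mono, rule subsetI)
    fix X assume X: "X \<in> (\<lambda>X. ({1..n}, {e \<in> nsets {1..n} 2. X e})) -`
        {G. \<forall>j<L. \<not> joined_column (edges G) (D j) U}"
    have "\<exists>e\<in>S j. \<not> X e" if j: "j \<in> J" for j
    proof -
      have "\<not> joined_column {e \<in> nsets {1..n} 2. X e} (D j) U" "D j \<inter> U = {}"
        using X j by (auto simp: J_def)
      then obtain x y where "x \<in> D j" "y \<in> D j \<union> U" "x \<noteq> y" "{x, y} \<notin> {e \<in> nsets {1..n} 2. X e}"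
        unfolding joined_column_def by blast
      moreover from this have "{x, y} \<in> S j" by (auto simp: S_def)
      ultimately show ?thesis using SI[OF j] by blast
    qed
    then show "X \<in> {X. \<forall>j\<in>J. \<exists>e\<in>S j. \<not> X e}" by blast
  qed simp
  also have "\<dots> = (\<Prod>j\<in>J. 1 - p ^ card (S j))"
    by (rule prob_no_block_present) (use p finJ disj SI in \<open>auto intro: finite_imp_finite_nsets\<close>)
  also have "\<dots> \<le> (\<Prod>j\<in>J. 1 - p ^ (c * (c + u)))"
    using p cardS by (intro prod_mono) (auto intro: power_decreasing power_le_one)
  also have "\<dots> = (1 - p ^ (c * (c + u))) ^ card J" by simp
  also have "\<dots> \<le> (1 - p ^ (c * (c + u))) ^ (L - u)"
    using p cardJ by (intro power_decreasing) (auto intro: power_le_one)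
  finally show ?thesis .
qed

text \<open>A union bound. Lists of length \<open>u\<close> stand in for the sets \<open>U\<close>,
  so that the number of bad events is exactly \<open>n ^ u\<close>.\<close>

lemma prob_joined_columns:
  fixes p :: real
  assumes p: "0 \<le> p" "p \<le> 1" and n: "0 < n"
    and D: "\<And>j. j < L \<Longrightarrow> D j \<subseteq> {1..n}" "\<And>j. j < L \<Longrightarrow> card (D j) = c" "disjoint_family_on D {..<L}"
  shows "measure_pmf.prob (gnp n p)
           {G. \<forall>U\<subseteq>{1..n}. card U \<le> u \<longrightarrow> (\<exists>j<L. joined_column (edges G) (D j) U)}
         \<ge> 1 - real n ^ u * (1 - p ^ (c * (c + u))) ^ (L - u)"
proof -
  define Xs where "Xs = {xs. set xs \<subseteq> {1..n} \<and> length xs = u}"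
  define Bad where "Bad xs = {G. \<forall>j<L. \<not> joined_column (edges G) (D j) (set xs)}" for xs
  let ?A = "{G. \<forall>U\<subseteq>{1..n}. card U \<le> u \<longrightarrow> (\<exists>j<L. joined_column (edges G) (D j) U)}"
  have Xs: "finite Xs" "card Xs = n ^ u"
    by (simp_all add: Xs_def finite_lists_length_eq card_lists_length_eq)
  have "- (\<Union>xs\<in>Xs. Bad xs) \<subseteq> ?A"
  proof (intro subsetI CollectI allI impI)
    fix G U assume G: "G \<in> - (\<Union>xs\<in>Xs. Bad xs)" and U: "U \<subseteq> {1..n}" "card U \<le> u"
    have "finite U" using U(1) by (rule finite_subset) simp
    then obtain ys where ys: "set ys = U" "distinct ys" using finite_distinct_list by blast
    \<comment> \<open>Padding with the vertex 1, available because \<open>0 < n\<close>, may enlarge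
      the set, but a column joined to the larger set is also joined to \<open>U\<close>.\<close>
    define xs where "xs = ys @ replicate (u - card U) 1"
    have "xs \<in> Xs"
      using ys U n by (auto simp: Xs_def xs_def distinct_card[symmetric])
    with G obtain j where "j < L" "joined_column (edges G) (D j) (set xs)"
      by (auto simp: Bad_def)
    moreover have "U \<subseteq> set xs" using ys by (auto simp: xs_def)
    ultimately show "\<exists>j<L. joined_column (edges G) (D j) U"
      unfolding joined_column_def by blast
  qed
  then have "measure_pmf.prob (gnp n p) (- (\<Union>xs\<in>Xs. Bad xs)) \<le> measure_pmf.prob (gnp n p) ?A"
    by (rule measure_pmf.finite_measure_mono) simp
  moreover have "measure_pmf.prob (gnp n p) (- (\<Union>xs\<in>Xs. Bad xs)) =
      1 - measure_pmf.prob (gnp n p) (\<Union>xs\<in>Xs. Bad xs)"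
    using measure_pmf.prob_compl[of "\<Union>xs\<in>Xs. Bad xs" "gnp n p"] by (simp add: Compl_eq_Diff_UNIV)
  moreover have "measure_pmf.prob (gnp n p) (\<Union>xs\<in>Xs. Bad xs) \<le>
      (\<Sum>xs\<in>Xs. measure_pmf.prob (gnp n p) (Bad xs))"
    by (rule measure_pmf.finite_measure_subadditive_finite) (use Xs in auto)
  moreover have "\<dots> \<le> (\<Sum>xs\<in>Xs. (1 - p ^ (c * (c + u))) ^ (L - u))"
    unfolding Bad_def
    by (intro sum_mono prob_no_joined_column p D) (auto simp: Xs_def intro: order_trans[OF card_length])
  moreover have "\<dots> = real n ^ u * (1 - p ^ (c * (c + u))) ^ (L - u)"
    by (simp add: Xs)
  ultimately show ?thesis by linarith
qed

section \<open>Choice of constants and the limit\<close>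

theorem theorem1p3:
  fixes p :: real and F :: "'a graph"
  assumes "0 < p" and "p < 1"
    and "fin_graph F" and "verts F \<noteq> {}" and "no_isolated_verts F"
  shows "\<exists>C>0. (\<lambda>n. measure_pmf.prob (gnp n p)
            {G. real (sat G F) \<le> C * real n * ln (real n)}) \<longlonglongrightarrow> 1"
proof -
  have "edges F \<noteq> {}" using assms(4,5) by (auto simp: no_isolated_verts_def)
  then obtain r s a c l0 where nofit: "\<not> (\<exists>c l. fits F r s a c l)" and "fits F r s (Suc a) c l0"
    using critical_fit_exists[OF assms(3)] by blast
  then obtain l where fit: "fits F r s (Suc a) c l"
    and lR: "\<forall>x\<in>verts F. l x < Suc a + card (verts F)"
    using fits_relabel[OF assms(3)] by blast
  define v where "v = card (verts F)"
  define R where "R = Suc a + v"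
  define Q where "Q = column_roles r s a v R"
  define d where "d = card Q"
  define u where "u = Suc (v + 2 * d)"
  \<comment> \<open>\<open>q\<close> bounds from below the chance that a column disjoint from a set
    of at most \<open>u\<close> vertices is joined to it. \<open>K\<close> makes
    \<open>(1 - q) ^ L n\<close> at most \<open>1 / n ^ (u + 1)\<close>, which beats the
    \<open>n ^ u\<close> events by a factor \<open>n\<close>.\<close>
  define q where "q = p ^ (d * (d + u))"
  define K where "K = (real u + 1) / q"
  define L where "L n = nat \<lceil>K * ln (real n)\<rceil>" for n :: nat
  \<comment> \<open>Rounding up in \<open>L n\<close> costs at most 1, which \<open>K + 1\<close>
    absorbs once \<open>ln n\<close> is at least 1. The summand 1 in the first factor makes
    positivity immediate.\<close>
  define C where "C = (real d + real v + 1) * (K + 1)"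
  have q: "0 < q" "q \<le> 1" using assms(1,2) by (auto simp: q_def intro: power_le_one)
  have K: "0 < K" using q by (simp add: K_def)
  have C: "0 < C" using K by (simp add: C_def)
  have L: "K * ln (real n) \<le> real (L n)" "real (L n) \<le> K * ln (real n) + 1" if "1 \<le> n" for n
    using that K by (auto simp: L_def of_nat_nat)
  \<comment> \<open>\<open>3 \<le> n\<close> ensures that \<open>ln n\<close> is at least 1; the
    other condition leaves room in \<open>{1..n}\<close> for \<open>L n\<close> disjoint intervals
    of length \<open>d\<close>, which serve as columns.\<close>
  have lower: "1 - exp (q * real u) / real n \<le>
      measure_pmf.prob (gnp n p) {G. real (sat G F) \<le> C * real n * ln (real n)}"
    if n: "3 \<le> n" "(K * ln (real n) + 1) * real d \<le> real n" for n
  proof -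
    define D where "D j = {j * d + 1..j * d + d}" for j
    have "real (L n * d) \<le> (K * ln (real n) + 1) * real d"
      using L(2)[of n] n(1) by (simp add: mult_right_mono)
    with n(2) have Ld: "L n * d \<le> n" by linarith
    have D1: "D j \<subseteq> {1..n}" if "j < L n" for j
    proof -
      have "j * d + d \<le> L n * d" using that by (metis add.commute mult_Suc mult_le_mono1 Suc_leI)
      with Ld show ?thesis by (auto simp: D_def)
    qed
    have D2: "card (D j) = d" for j by (simp add: D_def)
    have lt: "D i \<inter> D j = {}" if "i < j" for i j
    proof -
      have "i * d + d \<le> j * d" using that by (metis add.commute mult_Suc mult_le_mono1 Suc_leI)
      then show ?thesis by (auto simp: D_def)
    qed
    have D3: "disjoint_family_on D {..<L n}"
      unfolding disjoint_family_on_def by (metis lt inf_commute linorder_neq_iff)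
    let ?A = "{G. \<forall>U\<subseteq>{1..n}. card U \<le> u \<longrightarrow> (\<exists>j<L n. joined_column (edges G) (D j) U)}"
    have "1 - real n ^ u * (1 - q) ^ (L n - u) \<le> measure_pmf.prob (gnp n p) ?A"
      unfolding q_def by (rule prob_joined_columns) (use assms n D1 D2 D3 in auto)
    \<comment> \<open>Only on the support is \<open>G\<close> known to be a graph on
      \<open>{1..n}\<close>.\<close>
    also have "\<dots> = measure_pmf.prob (gnp n p) (?A \<inter> set_pmf (gnp n p))"
      by (simp add: measure_Int_set_pmf)
    also have "\<dots> \<le> measure_pmf.prob (gnp n p) {G. real (sat G F) \<le> C * real n * ln (real n)}"
    proof (rule measure_pmf.finite_measure_mono)
      show "?A \<inter> set_pmf (gnp n p) \<subseteq> {G. real (sat G F) \<le> C * real n * ln (real n)}"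
      proof (intro subsetI CollectI)
        fix G assume G: "G \<in> ?A \<inter> set_pmf (gnp n p)"
        then have V: "verts G = {1..n}" and fin: "fin_graph G"
          by (auto simp: gnp_def fin_graph_def)
        have "sat G F \<le> card (verts G) * (L n * (card Q + v))"
        proof (rule sat_le_of_joined_columns[OF assms(3) nofit fit, where R = R and D = D])
          show "l x < R" if "x \<in> verts F" for x using lR that by (simp add: R_def v_def)
        qed (use G V fin D1 D2 D3 in \<open>auto simp: Q_def v_def d_def u_def\<close>)
        then have "real (sat G F) \<le> real n * (real (L n) * (real d + real v))"
          using V by (simp add: d_def flip: of_nat_mult of_nat_add)
        also have "\<dots> \<le> real n * ((K + 1) * ln (real n) * (real d + real v + 1))"
        proof (intro mult_left_mono mult_mono)
          have "1 \<le> ln (real n)"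
          proof -
            have "exp 1 \<le> (3 :: real)" using exp_le by simp
            with n(1) show ?thesis by (subst ln_ge_iff) auto
          qed
          then show "real (L n) \<le> (K + 1) * ln (real n)"
            using L(2)[of n] n(1) by (simp add: algebra_simps)
          with \<open>1 \<le> ln (real n)\<close> show "0 \<le> (K + 1) * ln (real n)" using K by simp
        qed auto
        finally show "real (sat G F) \<le> C * real n * ln (real n)"
          by (simp add: C_def algebra_simps)
      qed
    qed simp
    finally have "1 - real n ^ u * (1 - q) ^ (L n - u) \<le>
      measure_pmf.prob (gnp n p) {G. real (sat G F) \<le> C * real n * ln (real n)}" .
    moreover have "real n ^ u * (1 - q) ^ (L n - u) \<le> exp (q * real u) / real n"
    proof -
      have "(1 - q) ^ (L n - u) \<le> exp (- q) ^ (L n - u)"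
        using q exp_ge_add_one_self[of "- q"] by (intro power_mono) auto
      also have "\<dots> = exp (- q * real (L n - u))" by (simp add: exp_of_nat_mult mult.commute flip: exp_of_nat2_mult)
      \<comment> \<open>The term \<open>q * real u\<close> pays for the up to \<open>u\<close>
        columns that meet \<open>U\<close>. Truncated subtraction is never below the real
        difference, so it goes in the right direction.\<close>
      also have "\<dots> \<le> exp (q * real u - (real u + 1) * ln (real n))"
      proof -
        have "K * ln (real n) - real u \<le> real (L n - u)" using L(1)[of n] n(1) by linarith
        then have "q * (K * ln (real n) - real u) \<le> q * real (L n - u)"
          using q by (intro mult_left_mono) auto
        moreover have "q * (K * ln (real n)) = (real u + 1) * ln (real n)"
          using q by (simp add: K_def)
        ultimately show ?thesis by (simp add: algebra_simps)
      qed
      also have "\<dots> = exp (q * real u) / real n ^ Suc u"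
      proof -
        have "exp ((real u + 1) * ln (real n)) = real n ^ Suc u"
          using n(1) exp_of_nat_mult[of "Suc u" "ln (real n)"] by (simp add: algebra_simps)
        then show ?thesis by (simp add: exp_diff)
      qed
      finally have "real n ^ u * (1 - q) ^ (L n - u) \<le> real n ^ u * (exp (q * real u) / real n ^ Suc u)"
        by (intro mult_left_mono) auto
      also have "\<dots> = exp (q * real u) / real n" using n(1) by simp
      finally show ?thesis .
    qed
    ultimately show ?thesis by linarith
  qed
  have "eventually (\<lambda>n. (K * ln (real n) + 1) * real d \<le> real n) sequentially"
    by real_asymp
  then have ev: "eventually (\<lambda>n. 1 - exp (q * real u) / real n \<le>
      measure_pmf.prob (gnp n p) {G. real (sat G F) \<le> C * real n * ln (real n)}) sequentially"
    using eventually_ge_at_top[of 3] by eventually_elim (rule lower)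
  have "(\<lambda>n. measure_pmf.prob (gnp n p) {G. real (sat G F) \<le> C * real n * ln (real n)}) \<longlonglongrightarrow> 1"
  proof (rule tendsto_sandwich[OF ev])
    show "(\<lambda>n. 1 - exp (q * real u) / real n) \<longlonglongrightarrow> 1" by real_asymp
  qed auto
  with C show ?thesis by blast
qed

end
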